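(* Let $X$ be a set, let $\phi$ be a closure operator on $X$, and let $\operatorname{Cld}(X,\phi)$ be its family of closed sets. The following are equivalent: (1) $(X,\phi)$ is an algebraic convex geometry; (2) there exists a non-empty set $\{\leq_i : i\in I\}$ of total orderings on $X$ such that $\operatorname{Cld}(X,\phi)=\bigvee_{Sp}\{\operatorname{Id}(X,\leq_i): i\in I\}$.
   Context: A closure operator on a set $X$ is a map $\phi:\operatorname{Pow}X\to\operatorname{Pow}X$ (where $\operatorname{Pow}X$ is the set of all subsets of $X$) such that $A\subseteq\phi(A)$, $A\subseteq B$ implies $\phi(A)\subseteq\phi(B)$, and $\phi(\phi(A))=\phi(A)$ for all $A,B\subseteq X$. It is algebraic if moreover $\phi(A)=\bigcup\{\phi(B): B\subseteq A,\ B\text{ finite}\}$ for all $A\subseteq X$. A set $A\subseteq X$ is closed if $\phi(A)=A$; $\operatorname{Cld}(X,\phi)$ denotes the family of all closed sets. The pair $(X,\phi)$ is a convex geometry if $\phi$ is a closure operator on $X$ with $\phi(\emptyset)=\emptyset$ satisfying the anti-exchange property: for all $x\neq y$ in $X$ and all closed $A\subseteq X$, if $x\in\phi(A\cup\{y\})$ and $x\notin A$, then $y\notin\phi(A\cup\{x\})$. It is an algebraic convex geometry if in addition $\phi$ is algebraic. A family $\mathcal{F}\subseteq\operatorname{Pow}X$ is algebraic if it is closed under arbitrary intersections (including the empty intersection, which equals $X$) and under unions of non-empty up-directed subfamilies (a family of sets is up-directed if any two members are contained in a common member). $\operatorname{S_p}(\operatorname{Pow}X)$ denotes the complete lattice of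 all algebraic families $\mathcal{F}\subseteq\operatorname{Pow}X$ ordered by inclusion, and $\bigvee_{Sp}$ is the join in this lattice: $\bigvee_{Sp}\{\mathcal{G}_i: i\in I\}$ is the smallest algebraic family containing $\bigcup_{i\in I}\mathcal{G}_i$. For a totally ordered set $(X,\leq)$, $\operatorname{Id}(X,\leq)$ denotes the family of all down-sets of $(X,\leq)$ (including $\emptyset$ and $X$), i.e. all $Q\subseteq X$ with $Q=\{p\in X: p\leq q\text{ for some }q\in Q\}$. *)

theory Defs
  imports Main "HOL-Library.FuncSet"
begin

text \<open>
  A closure operator on a carrier set \<open>X\<close> is a total HOL function of which only the
  values on subsets of \<open>X\<close> matter.
\<close>

definition closure_operator :: "'a set \<Rightarrow> ('a set \<Rightarrow> 'a set) \<Rightarrow> bool" where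
  "closure_operator X \<phi> \<longleftrightarrow>
     \<phi> \<in> Pow X \<rightarrow> Pow X \<and>
     (\<forall>A. A \<subseteq> X \<longrightarrow> A \<subseteq> \<phi> A) \<and>
     (\<forall>A B. A \<subseteq> B \<and> B \<subseteq> X \<longrightarrow> \<phi> A \<subseteq> \<phi> B) \<and>
     (\<forall>A. A \<subseteq> X \<longrightarrow> \<phi> (\<phi> A) = \<phi> A)"

definition algebraic_operator :: "'a set \<Rightarrow> ('a set \<Rightarrow> 'a set) \<Rightarrow> bool" where
  "algebraic_operator X \<phi> \<longleftrightarrow>
     (\<forall>A. A \<subseteq> X \<longrightarrow> \<phi> A = \<Union> {\<phi> B |B. B \<subseteq> A \<and> finite B})"

definition Cld :: "'a set \<Rightarrow> ('a set \<Rightarrow> 'a set) \<Rightarrow> 'a set set" where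
  "Cld X \<phi> = {A. A \<subseteq> X \<and> \<phi> A = A}"

definition convex_geometry :: "'a set \<Rightarrow> ('a set \<Rightarrow> 'a set) \<Rightarrow> bool" where
  "convex_geometry X \<phi> \<longleftrightarrow>
     closure_operator X \<phi> \<and> \<phi> {} = {} \<and>
     (\<forall>x\<in>X. \<forall>y\<in>X. \<forall>A\<in>Cld X \<phi>.
        x \<noteq> y \<and> x \<in> \<phi> (A \<union> {y}) \<and> x \<notin> A \<longrightarrow> y \<notin> \<phi> (A \<union> {x}))"

definition algebraic_convex_geometry :: "'a set \<Rightarrow> ('a set \<Rightarrow> 'a set) \<Rightarrow> bool" where
  "algebraic_convex_geometry X \<phi> \<longleftrightarrow> convex_geometry X \<phi> \<and> algebraic_operator X \<phi>"

definition up_directed :: "'a set set \<Rightarrow> bool" where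
  "up_directed \<G> \<longleftrightarrow> (\<forall>A\<in>\<G>. \<forall>B\<in>\<G>. \<exists>C\<in>\<G>. A \<subseteq> C \<and> B \<subseteq> C)"

text \<open>Intersecting with \<open>X\<close> below makes the empty intersection equal to \<open>X\<close>
  and changes no other intersection.\<close>

definition algebraic_family :: "'a set \<Rightarrow> 'a set set \<Rightarrow> bool" where
  "algebraic_family X \<F> \<longleftrightarrow>
     \<F> \<subseteq> Pow X \<and>
     (\<forall>\<G>. \<G> \<subseteq> \<F> \<longrightarrow> X \<inter> \<Inter> \<G> \<in> \<F>) \<and>
     (\<forall>\<G>. \<G> \<subseteq> \<F> \<and> \<G> \<noteq> {} \<and> up_directed \<G> \<longrightarrow> \<Union> \<G> \<in> \<F>)"

text \<open>The join of a set of families in the lattice of algebraic families on \<open>X\<close>. The least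
  element exists whenever all the families consist of subsets of \<open>X\<close>; see
  \<open>Sp_join_algebraic\<close>, \<open>Sp_join_upper\<close> and \<open>Sp_join_least\<close>.\<close>

definition Sp_join :: "'a set \<Rightarrow> 'a set set set \<Rightarrow> 'a set set" where
  "Sp_join X GG = (LEAST \<F>. algebraic_family X \<F> \<and> \<Union> GG \<subseteq> \<F>)"

text \<open>A pair \<open>(p, q) \<in> r\<close> means \<open>p \<le> q\<close>.\<close>

definition down_sets :: "'a set \<Rightarrow> 'a rel \<Rightarrow> 'a set set" where
  "down_sets X r = {Q. Q \<subseteq> X \<and> Q = {p \<in> X. \<exists>q\<in>Q. (p, q) \<in> r}}"

lemma algebraic_family_Pow: "algebraic_family X (Pow X)"
  unfolding algebraic_family_def by blast

lemma algebraic_family_Inter: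
  assumes "FF \<noteq> {}" and "\<And>\<F>. \<F> \<in> FF \<Longrightarrow> algebraic_family X \<F>"
  shows "algebraic_family X (\<Inter> FF)"
  unfolding algebraic_family_def
proof (intro conjI allI impI)
  show "\<Inter> FF \<subseteq> Pow X"
    using assms unfolding algebraic_family_def by blast
next
  fix \<G> assume "\<G> \<subseteq> \<Inter> FF"
  then show "X \<inter> \<Inter> \<G> \<in> \<Inter> FF"
    using assms(2) unfolding algebraic_family_def by (meson InterI Inter_lower subset_trans)
next
  fix \<G> assume "\<G> \<subseteq> \<Inter> FF \<and> \<G> \<noteq> {} \<and> up_directed \<G>"
  then show "\<Union> \<G> \<in> \<Inter> FF"
    using assms(2) unfolding algebraic_family_def by (meson InterI Inter_lower subset_trans)
qed

lemma Sp_join_eq_Inter: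
  assumes "\<Union> GG \<subseteq> Pow X"
  shows "Sp_join X GG = \<Inter> {\<F>. algebraic_family X \<F> \<and> \<Union> GG \<subseteq> \<F>}"
  unfolding Sp_join_def
proof (rule Least_equality)
  have "Pow X \<in> {\<F>. algebraic_family X \<F> \<and> \<Union> GG \<subseteq> \<F>}"
    using assms algebraic_family_Pow by blast
  then have "algebraic_family X (\<Inter> {\<F>. algebraic_family X \<F> \<and> \<Union> GG \<subseteq> \<F>})"
    by (intro algebraic_family_Inter) blast+
  then show "algebraic_family X (\<Inter> {\<F>. algebraic_family X \<F> \<and> \<Union> GG \<subseteq> \<F>}) \<and>
      \<Union> GG \<subseteq> \<Inter> {\<F>. algebraic_family X \<F> \<and> \<Union> GG \<subseteq> \<F>}"
    by blast
qed blast

lemma Sp_join_algebraic: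
  assumes "\<Union> GG \<subseteq> Pow X"
  shows "algebraic_family X (Sp_join X GG)"
  unfolding Sp_join_eq_Inter[OF assms]
  by (rule algebraic_family_Inter) (use assms algebraic_family_Pow in blast)+

lemma Sp_join_upper: "\<Union> GG \<subseteq> Pow X \<Longrightarrow> \<Union> GG \<subseteq> Sp_join X GG"
  by (auto simp: Sp_join_eq_Inter)

lemma Sp_join_least:
  "\<Union> GG \<subseteq> Pow X \<Longrightarrow> algebraic_family X \<F> \<Longrightarrow> \<Union> GG \<subseteq> \<F> \<Longrightarrow> Sp_join X GG \<subseteq> \<F>"
  by (auto simp: Sp_join_eq_Inter)

end

theory Submission
  imports Defs
begin

text \<open>
  Two observations carry the proof.

  A maximal chain \<open>C\<close> of closed sets of an algebraic convex geometry is the same thing as a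
  total order whose down-sets are all closed. Each point \<open>p\<close> determines a jump of \<open>C\<close>, from the
  union \<open>L\<close> of the members avoiding \<open>p\<close> to the intersection \<open>U\<close> of the members containing \<open>p\<close>.
  By maximality no closed set lies strictly between \<open>L\<close> and \<open>U\<close>, so any two points of \<open>U - L\<close>
  lie in each other's closure over \<open>L\<close>; anti-exchange forces \<open>U - L = {p}\<close>. Hence ordering
  the points by their jumps is antisymmetric. By Hausdorff's maximal principle every closed set
  lies on a maximal chain, so it is a down-set of such an order
  (\<open>closed_set_is_down_set\<close>), and the family of closed sets is even the union of the families
  of down-sets.

  Conversely, for a set \<open>R\<close> of total orders, call \<open>x\<close> dominated by a finite set \<open>F\<close> if \<open>x\<close> is
  below some element of \<open>F\<close> in every order of \<open>R\<close>. The points dominated by finite subsets of a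
  set \<open>A\<close> form the closure of \<open>A\<close> for the join of the families of down-sets
  (\<open>Sp_join_domination_closed\<close> and \<open>finitely_dominated_in_Sp_join\<close>). So this closure depends
  on finite sets only, and anti-exchange reduces to the antisymmetry of one order: if \<open>F\<close> does
  not dominate \<open>x\<close>, then some order puts \<open>x\<close> above all of \<open>F\<close>, and there the two hypotheses of
  an exchange between \<open>x\<close> and \<open>y\<close> become \<open>x \<le> y\<close> and \<open>y \<le> x\<close>.
\<close>

section \<open>Closed sets of a closure operator\<close>

lemma closure_subset_carrier:
  assumes "closure_operator X \<phi>" "A \<subseteq> X"
  shows "\<phi> A \<subseteq> X"
  using assms by (simp add: closure_operator_def Pi_iff)

lemma closure_extensive:
  assumes "closure_operator X \<phi>" "A \<subseteq> X"
  shows "A \<subseteq> \<phi> A"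
  using assms by (simp add: closure_operator_def)

lemma closure_mono:
  assumes "closure_operator X \<phi>" "A \<subseteq> B" "B \<subseteq> X"
  shows "\<phi> A \<subseteq> \<phi> B"
  using assms by (simp add: closure_operator_def)

lemma closure_closed:
  assumes "closure_operator X \<phi>" "A \<subseteq> X"
  shows "\<phi> A \<in> Cld X \<phi>"
  using assms by (simp add: closure_operator_def Cld_def Pi_iff)

lemma closure_least:
  assumes "closure_operator X \<phi>" "A \<subseteq> B" "B \<in> Cld X \<phi>"
  shows "\<phi> A \<subseteq> B"
  using closure_mono[OF assms(1,2)] assms(3) unfolding Cld_def by auto

lemma closed_subset_carrier: "A \<in> Cld X \<phi> \<Longrightarrow> A \<subseteq> X"
  by (simp add: Cld_def)

lemma closedI:
  assumes "closure_operator X \<phi>" "A \<subseteq> X" "\<phi> A \<subseteq> A"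
  shows "A \<in> Cld X \<phi>"
  using closure_extensive[OF assms(1,2)] assms(2,3) by (simp add: Cld_def)

lemma chain_up_directed:
  assumes "\<And>D E. D \<in> \<G> \<Longrightarrow> E \<in> \<G> \<Longrightarrow> D \<subseteq> E \<or> E \<subseteq> D"
  shows "up_directed \<G>"
  unfolding up_directed_def
proof (intro ballI)
  fix D E assume "D \<in> \<G>" "E \<in> \<G>"
  then show "\<exists>H\<in>\<G>. D \<subseteq> H \<and> E \<subseteq> H"
    using assms[of D E] by blast
qed

lemma finite_subset_of_directed_Union:
  assumes "finite F" "F \<subseteq> \<Union>\<G>" "\<G> \<noteq> {}" "up_directed \<G>"
  shows "\<exists>A\<in>\<G>. F \<subseteq> A"
  using assms(1,2)
proof (induction F)
  case empty
  then show ?case using assms(3) by auto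
next
  case (insert x F)
  then obtain A B where "A \<in> \<G>" "F \<subseteq> A" "B \<in> \<G>" "x \<in> B" by auto
  moreover then obtain C where "C \<in> \<G>" "A \<subseteq> C" "B \<subseteq> C"
    using assms(4) unfolding up_directed_def by meson
  ultimately show ?case by blast
qed

lemma algebraic_family_Inter_mem:
  assumes "algebraic_family X \<F>" "\<G> \<subseteq> \<F>"
  shows "X \<inter> \<Inter>\<G> \<in> \<F>"
  using assms by (simp add: algebraic_family_def)

lemma algebraic_family_Union_mem:
  assumes "algebraic_family X \<F>" "\<G> \<subseteq> \<F>" "\<G> \<noteq> {}" "up_directed \<G>"
  shows "\<Union>\<G> \<in> \<F>"
  using assms by (simp add: algebraic_family_def)

lemma Cld_algebraic_family:
  assumes cl: "closure_operator X \<phi>" and alg: "algebraic_operator X \<phi>"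
  shows "algebraic_family X (Cld X \<phi>)"
  unfolding algebraic_family_def
proof (intro conjI allI impI)
  show "Cld X \<phi> \<subseteq> Pow X" using closed_subset_carrier by blast
next
  fix \<G> assume \<G>: "\<G> \<subseteq> Cld X \<phi>"
  let ?I = "X \<inter> \<Inter>\<G>"
  have "\<phi> ?I \<subseteq> X" by (intro closure_subset_carrier[OF cl]) blast
  moreover have "\<phi> ?I \<subseteq> A" if "A \<in> \<G>" for A
    by (rule closure_least[OF cl]) (use that \<G> in blast)+
  ultimately have "\<phi> ?I \<subseteq> ?I" by blast
  then show "?I \<in> Cld X \<phi>"
    by (intro closedI[OF cl]) auto
next
  fix \<G> assume \<G>: "\<G> \<subseteq> Cld X \<phi> \<and> \<G> \<noteq> {} \<and> up_directed \<G>"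
  then have sub: "\<Union>\<G> \<subseteq> X" using closed_subset_carrier by blast
  have "\<phi> (\<Union>\<G>) = \<Union>{\<phi> B |B. B \<subseteq> \<Union>\<G> \<and> finite B}"
    using alg sub unfolding algebraic_operator_def by blast
  moreover have "\<phi> B \<subseteq> \<Union>\<G>" if B: "B \<subseteq> \<Union>\<G>" "finite B" for B
  proof -
    obtain A where "A \<in> \<G>" "B \<subseteq> A"
      using finite_subset_of_directed_Union[OF B(2,1)] \<G> by blast
    then show ?thesis using closure_least[OF cl, of B A] \<G> by blast
  qed
  ultimately have "\<phi> (\<Union>\<G>) \<subseteq> \<Union>\<G>" by blast
  then show "\<Union>\<G> \<in> Cld X \<phi>"
    by (intro closedI[OF cl sub])
qed

section \<open>Down-sets\<close>

lemma down_set_subset: "Q \<in> down_sets X r \<Longrightarrow> Q \<subseteq> X"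
  by (simp add: down_sets_def)

lemma down_set_downward:
  assumes "Q \<in> down_sets X r" "p \<in> X" "(p, q) \<in> r" "q \<in> Q"
  shows "p \<in> Q"
proof -
  have eq: "Q = {p \<in> X. \<exists>q\<in>Q. (p, q) \<in> r}"
    using assms(1) unfolding down_sets_def by (elim CollectE conjE)
  show ?thesis by (rule subsetD[OF equalityD2[OF eq]]) (use assms(2-4) in blast)
qed

section \<open>Total orders from maximal chains of closed sets\<close>

definition chain_order :: "'a set \<Rightarrow> 'a set set \<Rightarrow> 'a rel" where
  "chain_order X C = {(p, q). p \<in> X \<and> q \<in> X \<and> (\<forall>D\<in>C. q \<in> D \<longrightarrow> p \<in> D)}"

text \<open>
  The chain is taken among the closed sets comparable to the given one, so that maximality puts
  that set on it.
\<close>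

lemma maximal_chain_through:
  assumes "A \<in> \<F>"
  obtains C where "A \<in> C" "C \<subseteq> \<F>" "\<And>D E. D \<in> C \<Longrightarrow> E \<in> C \<Longrightarrow> D \<subseteq> E \<or> E \<subseteq> D"
    "\<And>B. B \<in> \<F> \<Longrightarrow> (\<And>D. D \<in> C \<Longrightarrow> B \<subseteq> D \<or> D \<subseteq> B) \<Longrightarrow> B \<in> C"
proof -
  define \<S> where "\<S> = {B \<in> \<F>. B \<subseteq> A \<or> A \<subseteq> B}"
  obtain C where "subset.maxchain \<S> C" using subset.Hausdorff by blast
  then have chain: "subset.chain \<S> C"
    and max: "\<And>S. subset.chain \<S> S \<Longrightarrow> \<not> C \<subset> S"
    unfolding subset.maxchain_def by blast+
  have comp: "D \<subseteq> E \<or> E \<subseteq> D" if "D \<in> C" "E \<in> C" for D E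
    using chain that unfolding subset_chain_def by blast
  have C: "C \<subseteq> \<S>" using chain unfolding subset_chain_def by blast
  have ins: "B \<in> C" if B: "B \<in> \<S>" "\<And>D. D \<in> C \<Longrightarrow> B \<subseteq> D \<or> D \<subseteq> B" for B
  proof -
    have "subset.chain \<S> (insert B C)"
      using B comp C unfolding subset_chain_def by blast
    then show ?thesis using max by blast
  qed
  have A: "A \<in> C" by (rule ins) (use assms C \<S>_def in blast)+
  show thesis
  proof (rule that[OF A _ comp])
    show "C \<subseteq> \<F>" using C \<S>_def by blast
    show "B \<in> C" if "B \<in> \<F>" "\<And>D. D \<in> C \<Longrightarrow> B \<subseteq> D \<or> D \<subseteq> B" for B
      by (rule ins) (use that A \<S>_def in blast)+
  qed
qed

text \<open>
  The jump argument: if \<open>p\<close> and \<open>q\<close> lie in the same members of a maximal chain, and \<open>L\<close> is the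
  union of the members avoiding them, then the closures of \<open>L \<union> {p}\<close> and \<open>L \<union> {q}\<close> are
  comparable to every member, hence are members themselves, and so each contains both
  points. Anti-exchange over \<open>L\<close> allows this only if \<open>p = q\<close>.
\<close>

lemma maximal_chain_separates:
  assumes acg: "algebraic_convex_geometry X \<phi>"
    and C: "C \<subseteq> Cld X \<phi>"
    and comp: "\<And>D E. D \<in> C \<Longrightarrow> E \<in> C \<Longrightarrow> D \<subseteq> E \<or> E \<subseteq> D"
    and max: "\<And>B. B \<in> Cld X \<phi> \<Longrightarrow> (\<And>D. D \<in> C \<Longrightarrow> B \<subseteq> D \<or> D \<subseteq> B) \<Longrightarrow> B \<in> C"
    and pq: "p \<in> X" "q \<in> X" "\<And>D. D \<in> C \<Longrightarrow> p \<in> D \<longleftrightarrow> q \<in> D"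
  shows "p = q"
proof (rule ccontr)
  assume "p \<noteq> q"
  have cl: "closure_operator X \<phi>" and alg: "algebraic_operator X \<phi>" and emp: "\<phi> {} = {}"
    and anti: "\<And>x y A. \<lbrakk>x \<in> X; y \<in> X; A \<in> Cld X \<phi>; x \<noteq> y; x \<in> \<phi> (A \<union> {y}); x \<notin> A\<rbrakk>
      \<Longrightarrow> y \<notin> \<phi> (A \<union> {x})"
    using acg unfolding algebraic_convex_geometry_def convex_geometry_def by blast+
  define L where "L = \<Union>{D \<in> C. p \<notin> D}"
  have "{} \<in> C" by (rule max) (auto simp: Cld_def emp)
  moreover have "up_directed {D \<in> C. p \<notin> D}"
    by (rule chain_up_directed) (use comp in auto)
  ultimately have L: "L \<in> Cld X \<phi>"
    unfolding L_def
    by (intro algebraic_family_Union_mem[OF Cld_algebraic_family[OF cl alg]]) (use C in auto)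
  have LX: "L \<subseteq> X" by (rule closed_subset_carrier[OF L])
  have notL: "p \<notin> L" "q \<notin> L" using pq(3) unfolding L_def by blast+
  have both: "p \<in> \<phi> (L \<union> {s}) \<and> q \<in> \<phi> (L \<union> {s})" if s: "s = p \<or> s = q" for s
  proof -
    let ?B = "\<phi> (L \<union> {s})"
    have sX: "L \<union> {s} \<subseteq> X" using s pq(1,2) LX by blast
    have sB: "L \<union> {s} \<subseteq> ?B" by (rule closure_extensive[OF cl sX])
    have "?B \<in> C"
    proof (rule max[OF closure_closed[OF cl sX]])
      fix D assume D: "D \<in> C"
      show "?B \<subseteq> D \<or> D \<subseteq> ?B"
      proof (cases "p \<in> D")
        case True
        then have "L \<subseteq> D" using comp[OF D] unfolding L_def by blast
        moreover have "s \<in> D" using True s pq(3)[OF D] by blast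
        ultimately show ?thesis using closure_least[OF cl, of "L \<union> {s}" D] D C by blast
      next
        case False
        then have "D \<subseteq> L" using D unfolding L_def by blast
        then show ?thesis using sB by blast
      qed
    qed
    then show ?thesis using sB s pq(3) by blast
  qed
  show False
    using anti[OF pq(1,2) L \<open>p \<noteq> q\<close> _ notL(1)] both by blast
qed

lemma closed_set_is_down_set:
  assumes acg: "algebraic_convex_geometry X \<phi>" and A: "A \<in> Cld X \<phi>"
  obtains r where "linear_order_on X r" "down_sets X r \<subseteq> Cld X \<phi>" "A \<in> down_sets X r"
proof -
  have cl: "closure_operator X \<phi>" and alg: "algebraic_operator X \<phi>" and emp: "\<phi> {} = {}"
    using acg unfolding algebraic_convex_geometry_def convex_geometry_def by blast+
  note fam = Cld_algebraic_family[OF cl alg]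
  obtain C where C: "A \<in> C" "C \<subseteq> Cld X \<phi>"
    and comp: "\<And>D E. D \<in> C \<Longrightarrow> E \<in> C \<Longrightarrow> D \<subseteq> E \<or> E \<subseteq> D"
    and max: "\<And>B. B \<in> Cld X \<phi> \<Longrightarrow> (\<And>D. D \<in> C \<Longrightarrow> B \<subseteq> D \<or> D \<subseteq> B) \<Longrightarrow> B \<in> C"
    using maximal_chain_through[OF A] by blast
  let ?r = "chain_order X C"
  have total: "(p, q) \<in> ?r \<or> (q, p) \<in> ?r" if "p \<in> X" "q \<in> X" for p q
    using that comp unfolding chain_order_def by blast
  have "antisym ?r"
  proof (rule antisymI)
    fix p q assume "(p, q) \<in> ?r" "(q, p) \<in> ?r"
    then show "p = q"
      by (intro maximal_chain_separates[OF acg C(2) comp max, of p q])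
        (auto simp: chain_order_def)
  qed
  then have "linear_order_on X ?r"
    unfolding linear_order_on_def partial_order_on_def preorder_on_def refl_on_def total_on_def
      trans_def
    using total by (auto simp: chain_order_def)
  moreover have "down_sets X ?r \<subseteq> Cld X \<phi>"
  proof
    fix Q assume Q: "Q \<in> down_sets X ?r"
    note QX = down_set_subset[OF Q]
    have down: "p \<in> Q" if "(p, q) \<in> ?r" "q \<in> Q" for p q
      by (rule down_set_downward[OF Q _ that]) (use that(1) in \<open>simp add: chain_order_def\<close>)
    \<comment> \<open>The principal down-set of \<open>q\<close> is the upper end of the jump at \<open>q\<close>, so \<open>Q\<close> is a chain
      union of closed sets.\<close>
    define P where "P q = X \<inter> \<Inter>{D \<in> C. q \<in> D}" for q
    have P: "P q \<in> Cld X \<phi>" for q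
      unfolding P_def by (rule algebraic_family_Inter_mem[OF fam]) (use C(2) in blast)
    have P_iff: "p \<in> P q \<longleftrightarrow> (p, q) \<in> ?r" if "q \<in> X" for p q
      using that unfolding P_def chain_order_def by blast
    show "Q \<in> Cld X \<phi>"
    proof (cases "Q = {}")
      case True
      then show ?thesis by (simp add: Cld_def emp)
    next
      case False
      have P_mono: "P p \<subseteq> P q" if "(p, q) \<in> ?r" for p q
        using that unfolding P_def chain_order_def by auto
      have "up_directed (P ` Q)"
      proof (rule chain_up_directed)
        fix D E assume "D \<in> P ` Q" "E \<in> P ` Q"
        then obtain p q where pq: "p \<in> Q" "D = P p" "q \<in> Q" "E = P q" by blast
        then show "D \<subseteq> E \<or> E \<subseteq> D" using total[of p q] P_mono QX by blast
      qed
      then have "\<Union>(P ` Q) \<in> Cld X \<phi>"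
        by (intro algebraic_family_Union_mem[OF fam]) (use P False in auto)
      moreover have "\<Union>(P ` Q) = Q"
      proof
        show "\<Union>(P ` Q) \<subseteq> Q" using down P_iff QX by blast
        show "Q \<subseteq> \<Union>(P ` Q)" using QX unfolding P_def by blast
      qed
      ultimately show ?thesis by simp
    qed
  qed
  moreover have "A \<in> down_sets X ?r"
    using closed_subset_carrier[OF A] C(1) unfolding down_sets_def chain_order_def by blast
  ultimately show thesis by (rule that)
qed

section \<open>The join of the families of down-sets\<close>

definition dominated :: "'a set \<Rightarrow> 'a rel set \<Rightarrow> 'a set \<Rightarrow> 'a set" where
  "dominated X R F = {x \<in> X. \<forall>r\<in>R. \<exists>f\<in>F. (x, f) \<in> r}"

lemma dominated_mono: "F \<subseteq> G \<Longrightarrow> dominated X R F \<subseteq> dominated X R G"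
  unfolding dominated_def by blast

lemma subset_dominated:
  assumes "\<And>r. r \<in> R \<Longrightarrow> linear_order_on X r" "F \<subseteq> X"
  shows "F \<subseteq> dominated X R F"
  using assms
  unfolding dominated_def linear_order_on_def partial_order_on_def preorder_on_def refl_on_def
  by blast

lemma down_sets_families_in_Pow: "\<Union>{down_sets X r |r. r \<in> R} \<subseteq> Pow X"
  using down_set_subset by blast

text \<open>
  The sets closed under domination by their finite subsets form an algebraic family containing
  all down-sets. Finiteness is what makes it stable under directed unions.
\<close>

lemma Sp_join_domination_closed:
  assumes A: "A \<in> Sp_join X {down_sets X r |r. r \<in> R}"
    and F: "finite F" "F \<subseteq> A"
  shows "dominated X R F \<subseteq> A"
proof -
  define \<F> where "\<F> = {A. A \<subseteq> X \<and> (\<forall>F. finite F \<and> F \<subseteq> A \<longrightarrow> dominated X R F \<subseteq> A)}"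
  have "algebraic_family X \<F>"
    unfolding algebraic_family_def
  proof (intro conjI allI impI)
    show "\<F> \<subseteq> Pow X" unfolding \<F>_def by blast
  next
    fix \<G> assume \<G>: "\<G> \<subseteq> \<F>"
    have "dominated X R F \<subseteq> X \<inter> \<Inter>\<G>" if "finite F" "F \<subseteq> X \<inter> \<Inter>\<G>" for F
    proof -
      have "dominated X R F \<subseteq> X" unfolding dominated_def by blast
      moreover have "dominated X R F \<subseteq> A" if "A \<in> \<G>" for A
        using that \<G> \<open>finite F\<close> \<open>F \<subseteq> X \<inter> \<Inter>\<G>\<close> unfolding \<F>_def by blast
      ultimately show ?thesis by blast
    qed
    then show "X \<inter> \<Inter>\<G> \<in> \<F>" unfolding \<F>_def by blast
  next
    fix \<G> assume \<G>: "\<G> \<subseteq> \<F> \<and> \<G> \<noteq> {} \<and> up_directed \<G>"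
    have "dominated X R F \<subseteq> \<Union>\<G>" if F: "finite F" "F \<subseteq> \<Union>\<G>" for F
    proof -
      obtain A where "A \<in> \<G>" "F \<subseteq> A"
        using finite_subset_of_directed_Union[OF F] \<G> by blast
      moreover then have "A \<in> \<F>" using \<G> by blast
      ultimately show ?thesis using F(1) unfolding \<F>_def by blast
    qed
    moreover have "\<Union>\<G> \<subseteq> X" using \<G> unfolding \<F>_def by blast
    ultimately show "\<Union>\<G> \<in> \<F>" unfolding \<F>_def by blast
  qed
  moreover have "\<Union>{down_sets X r |r. r \<in> R} \<subseteq> \<F>"
  proof
    fix Q assume "Q \<in> \<Union>{down_sets X r |r. r \<in> R}"
    then obtain r where r: "r \<in> R" "Q \<in> down_sets X r" by blast
    have "dominated X R F \<subseteq> Q" if "F \<subseteq> Q" for F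
      using r(1) down_set_downward[OF r(2)] that unfolding dominated_def by blast
    then show "Q \<in> \<F>" using down_set_subset[OF r(2)] unfolding \<F>_def by blast
  qed
  ultimately have "A \<in> \<F>"
    using Sp_join_least[OF down_sets_families_in_Pow] A by blast
  then show ?thesis using F unfolding \<F>_def by blast
qed

text \<open>
  The points dominated by \<open>F\<close> form the intersection, over the orders, of the down-sets
  generated by \<open>F\<close>; those dominated by some finite subset of \<open>A\<close> form a directed union of such
  intersections.
\<close>

lemma finitely_dominated_in_Sp_join:
  assumes lin: "\<And>r. r \<in> R \<Longrightarrow> linear_order_on X r"
  shows "\<Union>{dominated X R F |F. finite F \<and> F \<subseteq> A} \<in> Sp_join X {down_sets X r |r. r \<in> R}"
    (is "_ \<in> ?J")
proof -
  note alg = Sp_join_algebraic[OF down_sets_families_in_Pow, of X R]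
  have dom: "dominated X R F \<in> ?J" for F
  proof -
    define G where "G r = {x \<in> X. \<exists>f\<in>F. (x, f) \<in> r}" for r
    have "G r \<in> ?J" if "r \<in> R" for r
    proof -
      have "G r \<in> down_sets X r"
        using lin[OF that]
        unfolding down_sets_def G_def linear_order_on_def partial_order_on_def preorder_on_def
          refl_on_def trans_def
        by blast
      then show ?thesis
        using Sp_join_upper[OF down_sets_families_in_Pow, of X R] that by blast
    qed
    then have "X \<inter> \<Inter>(G ` R) \<in> ?J"
      by (intro algebraic_family_Inter_mem[OF alg]) blast
    moreover have "X \<inter> \<Inter>(G ` R) = dominated X R F"
      unfolding G_def dominated_def by blast
    ultimately show ?thesis by simp
  qed
  have "up_directed {dominated X R F |F. finite F \<and> F \<subseteq> A}"
    unfolding up_directed_def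
  proof (intro ballI)
    fix D E
    assume "D \<in> {dominated X R F |F. finite F \<and> F \<subseteq> A}"
      and "E \<in> {dominated X R F |F. finite F \<and> F \<subseteq> A}"
    then obtain F G where FG: "D = dominated X R F" "E = dominated X R G"
      "finite (F \<union> G)" "F \<union> G \<subseteq> A" by auto
    then have "D \<subseteq> dominated X R (F \<union> G)" "E \<subseteq> dominated X R (F \<union> G)"
      by (simp_all add: dominated_mono)
    then show "\<exists>H\<in>{dominated X R F |F. finite F \<and> F \<subseteq> A}. D \<subseteq> H \<and> E \<subseteq> H"
      using FG(3,4) by blast
  qed
  moreover have "{dominated X R F |F. finite F \<and> F \<subseteq> A} \<noteq> {}" by blast
  moreover have "{dominated X R F |F. finite F \<and> F \<subseteq> A} \<subseteq> ?J" using dom by blast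
  ultimately show ?thesis by (intro algebraic_family_Union_mem[OF alg])
qed

lemma closure_finitely_dominated:
  assumes cl: "closure_operator X \<phi>"
    and lin: "\<And>r. r \<in> R \<Longrightarrow> linear_order_on X r"
    and eq: "Cld X \<phi> = Sp_join X {down_sets X r |r. r \<in> R}"
    and "A \<subseteq> X" "x \<in> \<phi> A"
  obtains F where "finite F" "F \<subseteq> A" "x \<in> dominated X R F"
proof -
  let ?U = "\<Union>{dominated X R F |F. finite F \<and> F \<subseteq> A}"
  have "A \<subseteq> ?U"
  proof
    fix a assume "a \<in> A"
    then have "a \<in> dominated X R {a}"
      using subset_dominated[OF lin, of R "{a}"] \<open>A \<subseteq> X\<close> by blast
    then show "a \<in> ?U" using \<open>a \<in> A\<close> by blast
  qed
  moreover have "?U \<in> Cld X \<phi>"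
    using finitely_dominated_in_Sp_join[OF lin] eq by blast
  ultimately have "x \<in> ?U" using closure_least[OF cl] \<open>x \<in> \<phi> A\<close> by blast
  then show thesis using that by blast
qed

section \<open>The equivalence\<close>

lemma algebraic_convex_geometry_of_orders:
  assumes cl: "closure_operator X \<phi>" and "R \<noteq> {}"
    and lin: "\<And>r. r \<in> R \<Longrightarrow> linear_order_on X r"
    and eq: "Cld X \<phi> = Sp_join X {down_sets X r |r. r \<in> R}"
  shows "algebraic_convex_geometry X \<phi>"
proof -
  have closed: "dominated X R F \<subseteq> A" if "A \<in> Cld X \<phi>" "finite F" "F \<subseteq> A" for A F
    by (rule Sp_join_domination_closed) (use that eq in blast)+
  have "\<phi> {} = {}"
  proof -
    obtain r where "r \<in> R" using \<open>R \<noteq> {}\<close> by blast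
    moreover have "{} \<in> down_sets X r" unfolding down_sets_def by blast
    ultimately have "{} \<in> Cld X \<phi>"
      unfolding eq using Sp_join_upper[OF down_sets_families_in_Pow, of X R] by blast
    then show ?thesis by (simp add: Cld_def)
  qed
  moreover have "y \<notin> \<phi> (A \<union> {x})"
    if xy: "x \<in> X" "y \<in> X" "x \<noteq> y" and A: "A \<in> Cld X \<phi>" "x \<notin> A" and x: "x \<in> \<phi> (A \<union> {y})"
    for x y A
  proof
    assume y: "y \<in> \<phi> (A \<union> {x})"
    have AX: "A \<subseteq> X" by (rule closed_subset_carrier[OF A(1)])
    obtain F where F: "finite F" "F \<subseteq> A \<union> {y}" "x \<in> dominated X R F"
      by (rule closure_finitely_dominated[OF cl lin eq _ x]) (use AX xy in auto)
    obtain G where G: "finite G" "G \<subseteq> A \<union> {x}" "y \<in> dominated X R G"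
      by (rule closure_finitely_dominated[OF cl lin eq _ y]) (use AX xy in auto)
    \<comment> \<open>\<open>H\<close> collects the part of both witnesses inside \<open>A\<close>. As \<open>A\<close> is closed and avoids \<open>x\<close>, \<open>H\<close> does
      not dominate \<open>x\<close>, and the order \<open>r\<close> that shows it serves both exchanges.\<close>
    define H where "H = (F \<union> G) \<inter> A"
    have H: "finite H" "H \<subseteq> A" "F \<subseteq> H \<union> {y}" "G \<subseteq> H \<union> {x}"
      using F G unfolding H_def by auto
    have "x \<notin> dominated X R H" using closed[OF A(1) H(1,2)] A(2) by blast
    then obtain r where r: "r \<in> R" "\<And>h. h \<in> H \<Longrightarrow> (x, h) \<notin> r"
      using xy(1) unfolding dominated_def by blast
    have trans: "trans r" and antisym: "antisym r"
      using lin[OF r(1)] unfolding linear_order_on_def partial_order_on_def preorder_on_def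
      by blast+
    have xy_le: "(x, y) \<in> r"
      using F(3) H(3) r unfolding dominated_def by blast
    moreover have "(y, x) \<in> r"
    proof -
      obtain g where g: "g \<in> G" "(y, g) \<in> r"
        using G(3) r(1) unfolding dominated_def by blast
      then have "g \<notin> H" using r(2) transD[OF trans xy_le] by blast
      then show ?thesis using g H(4) by blast
    qed
    ultimately show False using antisymD[OF antisym] xy(3) by blast
  qed
  moreover have "\<phi> A = \<Union>{\<phi> B |B. B \<subseteq> A \<and> finite B}" if A: "A \<subseteq> X" for A
  proof
    show "\<Union>{\<phi> B |B. B \<subseteq> A \<and> finite B} \<subseteq> \<phi> A" using closure_mono[OF cl _ A] by blast
    show "\<phi> A \<subseteq> \<Union>{\<phi> B |B. B \<subseteq> A \<and> finite B}"
    proof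
      fix x assume x: "x \<in> \<phi> A"
      obtain F where F: "finite F" "F \<subseteq> A" "x \<in> dominated X R F"
        by (rule closure_finitely_dominated[OF cl lin eq A x])
      then have "F \<subseteq> X" using A by blast
      then have "x \<in> \<phi> F"
        using closed[OF closure_closed[OF cl] F(1) closure_extensive[OF cl]] F(3) by blast
      then show "x \<in> \<Union>{\<phi> B |B. B \<subseteq> A \<and> finite B}" using F by blast
    qed
  qed
  ultimately show ?thesis
    using cl unfolding algebraic_convex_geometry_def convex_geometry_def algebraic_operator_def
    by blast
qed

theorem theorem23:
  fixes X :: "'a set" and \<phi> :: "'a set \<Rightarrow> 'a set"
  assumes "closure_operator X \<phi>"
  shows "algebraic_convex_geometry X \<phi> \<longleftrightarrow>
    (\<exists>R :: 'a rel set. R \<noteq> {} \<and> (\<forall>r\<in>R. linear_order_on X r) \<and>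
       Cld X \<phi> = Sp_join X {down_sets X r |r. r \<in> R})"
proof
  assume acg: "algebraic_convex_geometry X \<phi>"
  then have fam: "algebraic_family X (Cld X \<phi>)" and emp: "{} \<in> Cld X \<phi>"
    using Cld_algebraic_family[OF assms]
    unfolding algebraic_convex_geometry_def convex_geometry_def by (simp_all add: Cld_def)
  define R where "R = {r. linear_order_on X r \<and> down_sets X r \<subseteq> Cld X \<phi>}"
  have mem: "\<exists>r\<in>R. A \<in> down_sets X r" if A: "A \<in> Cld X \<phi>" for A
  proof -
    obtain r where "linear_order_on X r" "down_sets X r \<subseteq> Cld X \<phi>" "A \<in> down_sets X r"
      by (rule closed_set_is_down_set[OF acg A])
    then show ?thesis by (auto simp: R_def)
  qed
  have "R \<noteq> {}" using mem[OF emp] by blast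
  moreover have "\<forall>r\<in>R. linear_order_on X r" by (simp add: R_def)
  moreover have "Cld X \<phi> = Sp_join X {down_sets X r |r. r \<in> R}"
  proof
    show "Cld X \<phi> \<subseteq> Sp_join X {down_sets X r |r. r \<in> R}"
    proof
      fix A assume "A \<in> Cld X \<phi>"
      then obtain r where "r \<in> R" "A \<in> down_sets X r" using mem by blast
      then show "A \<in> Sp_join X {down_sets X r |r. r \<in> R}"
        using Sp_join_upper[OF down_sets_families_in_Pow, of X R] by blast
    qed
    show "Sp_join X {down_sets X r |r. r \<in> R} \<subseteq> Cld X \<phi>"
      by (rule Sp_join_least[OF down_sets_families_in_Pow fam]) (auto simp: R_def)
  qed
  ultimately show "\<exists>R :: 'a rel set. R \<noteq> {} \<and> (\<forall>r\<in>R. linear_order_on X r) \<and>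
       Cld X \<phi> = Sp_join X {down_sets X r |r. r \<in> R}"
    by (intro exI[of _ R] conjI)
next
  assume "\<exists>R :: 'a rel set. R \<noteq> {} \<and> (\<forall>r\<in>R. linear_order_on X r) \<and>
       Cld X \<phi> = Sp_join X {down_sets X r |r. r \<in> R}"
  then obtain R where "R \<noteq> {}" "\<forall>r\<in>R. linear_order_on X r"
    "Cld X \<phi> = Sp_join X {down_sets X r |r. r \<in> R}" by (elim exE conjE)
  then show "algebraic_convex_geometry X \<phi>"
    by (intro algebraic_convex_geometry_of_orders[OF assms]) simp_all
qed

end
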